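(* Let $r_0$ denote the unique real root of the equation $4r^3+r-2=0$. Then for every $f\in H^\infty_1(\mathbb{D})$ and every $N\in\mathbb{N}$, $$\sup_{z\in\mathbb{T}}\left|(S_N(f))(r_0z)\right|\leq \|f\|_\infty.$$ Moreover, $r_0=R_3$, where $R_3$ is the largest number such that $\sup_{z\in\mathbb{T}}|(S_3(f))(R_3z)|\leq\|f\|_\infty$ for all $f\in H^\infty_1(\mathbb{D})$; and the constant $r_0$ in the displayed inequality cannot be replaced by a larger number, that is, for every real $r>r_0$ there exist $f\in H^\infty_1(\mathbb{D})$ and $N\in\mathbb{N}$ such that $\sup_{z\in\mathbb{T}}|(S_N(f))(rz)|>\|f\|_\infty$.
   Context: $\mathbb{D}$ is the open unit disc in $\mathbb{C}$ and $\mathbb{T}=\partial\mathbb{D}$ is the unit circle; $\mathbb{N}=\{1,2,3,\dots\}$. $H^\infty(\mathbb{D})$ is the Banach algebra of bounded (scalar-valued) analytic functions on $\mathbb{D}$ with norm $\|f\|_\infty=\sup_{z\in\mathbb{D}}|f(z)|$. The Neil algebra is $H^\infty_1(\mathbb{D})=\{f\in H^\infty(\mathbb{D}): f'(0)=0\}$. For an analytic function $f(z)=\sum_{n=0}^\infty a_nz^n$ on $\mathbb{D}$ and $N\in\mathbb{N}$, the $N$-th partial sum is the polynomial $(S_N(f))(z)=\sum_{n=0}^N a_nz^n$. *)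

theory Defs
  imports "HOL-Complex_Analysis.Complex_Analysis"
begin

text \<open>Functions on the open unit disc are represented by total functions on the complex numbers;
  their values outside the disc are irrelevant to all notions below that are applied to them.\<close>

definition Hinf :: "(complex \<Rightarrow> complex) set" where
  "Hinf = {f. f analytic_on ball 0 1 \<and> bounded (f ` ball 0 1)}"

definition Hinf_norm :: "(complex \<Rightarrow> complex) \<Rightarrow> real" where
  "Hinf_norm f = (SUP z\<in>ball 0 1. norm (f z))"

definition Neil_algebra :: "(complex \<Rightarrow> complex) set" where
  "Neil_algebra = {f \<in> Hinf. deriv f 0 = 0}"

definition partial_sum :: "nat \<Rightarrow> (complex \<Rightarrow> complex) \<Rightarrow> complex \<Rightarrow> complex" where
  "partial_sum N f z = (\<Sum>n\<le>N. fps_nth (fps_expansion f 0) n * z ^ n)"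

text \<open>The coefficients used in \<^const>\<open>partial_sum\<close> are those of the power series of \<open>f\<close> on the
  whole unit disc.\<close>

lemma fps_expansion_sums_on_disc:
  assumes "f analytic_on ball 0 1" and "z \<in> ball 0 1"
  shows "(\<lambda>n. fps_nth (fps_expansion f 0) n * z ^ n) sums f z"
  using holomorphic_power_series[OF analytic_imp_holomorphic[OF assms(1)] assms(2)]
  by (simp add: fps_expansion_def)

text \<open>The supremum below is taken over the unit circle; \<open>r\<close> is an arbitrary real number (the
  partial sum is a polynomial, so it can be evaluated at \<open>r * z\<close> also when \<open>r \<ge> 1\<close>).\<close>

definition circle_sup :: "nat \<Rightarrow> (complex \<Rightarrow> complex) \<Rightarrow> real \<Rightarrow> real" where
  "circle_sup N f r = (SUP z\<in>sphere 0 1. norm (partial_sum N f (of_real r * z)))"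

definition admissible_radius :: "nat \<Rightarrow> real \<Rightarrow> bool" where
  "admissible_radius N r \<longleftrightarrow> (\<forall>f\<in>Neil_algebra. circle_sup N f r \<le> Hinf_norm f)"

definition is_largest_admissible_radius :: "nat \<Rightarrow> real \<Rightarrow> bool" where
  "is_largest_admissible_radius N R \<longleftrightarrow>
     admissible_radius N R \<and> (\<forall>r. admissible_radius N r \<longrightarrow> r \<le> R)"

definition r0 :: real where
  "r0 = (THE r. 4 * r ^ 3 + r - 2 = 0)"

end

theory Submission
  imports Defs
begin

text \<open>The map sending \<open>f\<close> to \<open>S\<^sub>N f (r z)\<close> is convolution on the circle with any trigonometric polynomial
  \<open>1 + 2 c cos \<theta> + 2 \<Sum>\<^sub>n r\<^sup>n cos n\<theta>\<close>, \<open>2 \<le> n \<le> N\<close>, where \<open>c\<close> is arbitrary since \<open>f\<close> has no linear term; if this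
  kernel is nonnegative, its total mass is one and convolution does not increase the supremum norm.
  For \<open>N = 3\<close> a suitable \<open>c\<close> makes the kernel at \<open>r0\<close> equal to \<open>8 r\<^sup>3 (cos \<theta> + 1) (cos \<theta> - b)\<^sup>2\<close>; for
  \<open>N \<ge> 4\<close> the choice \<open>c = r\<close> works, by comparison with the Poisson kernel.
  For \<open>r > r0\<close> the function \<open>(q + B) / (1 + q B)\<close> with \<open>B = z\<^sup>2 (z + a) / (1 + a z)\<close>, \<open>a = 1 / (2 r)\<close>, is
  bounded by one, and the value of its third partial sum at \<open>r\<close> is
  \<open>1 + (1 - q) ((1 + q) (4 r\<^sup>3 + r) / 4 - 1)\<close>, which exceeds one for \<open>q\<close> close to one.\<close>

section \<open>Convolution on the circle with a cosine polynomial\<close>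

definition cos_kernel :: "(nat \<Rightarrow> real) \<Rightarrow> nat \<Rightarrow> complex \<Rightarrow> real" where
  "cos_kernel c N u = 1 + 2 * (\<Sum>n=1..N. c n * Re (u ^ n))"

text \<open>On the unit circle \<open>2 Re (u^n) = u^n + u^(-n)\<close>. Read as a contour integral,
  the \<open>u^(-n)\<close> part gives the n-th Taylor coefficient by Cauchy's formula, and the
  \<open>u^n\<close> part vanishes by Cauchy's theorem.\<close>

lemma has_integral_mult_cos_kernel:
  assumes g: "g holomorphic_on ball 0 R" and R: "R > 1" and c0: "c 0 = 1"
  shows "((\<lambda>t. g (circlepath 0 1 t) * of_real (cos_kernel c N (circlepath 0 1 t)))
           has_integral (\<Sum>n\<le>N. of_real (c n) * fps_nth (fps_expansion g 0) n)) {0..1}"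
proof -
  have cont: "continuous_on (cball 0 1) g" and hol: "g holomorphic_on ball 0 1"
    using R by (auto intro!: holomorphic_on_imp_continuous_on holomorphic_on_subset[OF g])
  have pos: "((\<lambda>u. g u / u ^ Suc n) has_contour_integral 2 * pi * \<i> * fps_nth (fps_expansion g 0) n)
      (circlepath 0 1)" for n
    using Cauchy_has_contour_integral_higher_derivative_circlepath[OF cont hol, of 0 n]
    by (simp add: fps_expansion_def)
  \<comment> \<open>The exponent is \<open>n - 1\<close> because \<open>du = 2 pi i u dt\<close>
    supplies one factor \<open>u\<close>; the sum below uses only \<open>n \<ge> 1\<close>.\<close>
  have neg: "((\<lambda>u. g u * u ^ (n - 1)) has_contour_integral 0) (circlepath 0 1)" for n
    by (rule Cauchy_theorem_disc_simple[of _ 0 R])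
       (use R in \<open>auto intro!: holomorphic_intros g\<close>)
  have split: "{..N} = insert 0 {1..N}" by auto
  have sum_eq: "2 * pi * \<i> * fps_nth (fps_expansion g 0) 0 +
      (\<Sum>n=1..N. of_real (c n) * (2 * pi * \<i> * fps_nth (fps_expansion g 0) n + 0)) =
      2 * pi * \<i> * (\<Sum>n\<le>N. of_real (c n) * fps_nth (fps_expansion g 0) n)"
    unfolding split by (simp add: c0 algebra_simps sum_distrib_left)
  have "((\<lambda>u. g u / u ^ Suc 0 + (\<Sum>n=1..N. of_real (c n) * (g u / u ^ Suc n + g u * u ^ (n - 1))))
      has_contour_integral 2 * pi * \<i> * (\<Sum>n\<le>N. of_real (c n) * fps_nth (fps_expansion g 0) n))
      (circlepath 0 1)"
    unfolding sum_eq[symmetric]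
    by (intro has_contour_integral_add has_contour_integral_sum has_contour_integral_lmul pos neg)
       auto
  moreover have vd: "vector_derivative (circlepath 0 1) (at t) = 2 * pi * \<i> * circlepath 0 1 t" for t
    unfolding vector_derivative_circlepath by (simp add: circlepath)
  ultimately have *: "((\<lambda>t. (g (circlepath 0 1 t) / circlepath 0 1 t ^ Suc 0 + (\<Sum>n=1..N. of_real (c n) *
        (g (circlepath 0 1 t) / circlepath 0 1 t ^ Suc n +
         g (circlepath 0 1 t) * circlepath 0 1 t ^ (n - 1)))) * (2 * pi * \<i> * circlepath 0 1 t))
      has_integral 2 * pi * \<i> * (\<Sum>n\<le>N. of_real (c n) * fps_nth (fps_expansion g 0) n)) {0..1}"
    by (simp only: has_contour_integral vd)
  \<comment> \<open>Here \<open>1 / u^n\<close> is the conjugate of \<open>u^n\<close>, so each pair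
    of powers adds up to a real number.\<close>
  have kernel: "(g u / u ^ Suc 0 + (\<Sum>n=1..N. of_real (c n) * (g u / u ^ Suc n + g u * u ^ (n - 1)))) * u
      = g u * of_real (cos_kernel c N u)" if u: "norm u = 1" for u
  proof -
    have [simp]: "u \<noteq> 0" using u by auto
    have "u * cnj u = 1"
      using u by (simp flip: complex_norm_square)
    then have "inverse u = cnj u" by (rule inverse_unique)
    then have inv: "1 / u ^ n = cnj (u ^ n)" for n
      by (metis complex_cnj_power inverse_eq_divide power_inverse)
    have "(g u / u ^ Suc n + g u * u ^ (n - 1)) * u = g u * of_real (2 * Re (u ^ n))"
      if "n \<in> {1..N}" for n
    proof -
      from that have "n \<noteq> 0" by simp
      then obtain m where n: "n = Suc m" using not0_implies_Suc by blast
      have "(g u / u ^ Suc n + g u * u ^ (n - 1)) * u = g u * (u ^ n + 1 / u ^ n)"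
        by (simp add: n field_simps)
      also have "\<dots> = g u * of_real (2 * Re (u ^ n))"
        by (simp only: inv complex_add_cnj)
      finally show ?thesis .
    qed
    then have "(\<Sum>n=1..N. of_real (c n) * (g u / u ^ Suc n + g u * u ^ (n - 1))) * u =
        (\<Sum>n=1..N. of_real (c n) * (g u * of_real (2 * Re (u ^ n))))"
      unfolding sum_distrib_right by (intro sum.cong) (simp_all add: mult.assoc)
    then show ?thesis
      by (simp add: cos_kernel_def distrib_right sum_distrib_left algebra_simps)
  qed
  have "((\<lambda>t. 2 * pi * \<i> * (g (circlepath 0 1 t) * of_real (cos_kernel c N (circlepath 0 1 t))))
      has_integral 2 * pi * \<i> * (\<Sum>n\<le>N. of_real (c n) * fps_nth (fps_expansion g 0) n)) {0..1}"
  proof (rule has_integral_eq[OF _ *])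
    fix t :: real
    show "(g (circlepath 0 1 t) / circlepath 0 1 t ^ Suc 0 + (\<Sum>n=1..N. of_real (c n) *
        (g (circlepath 0 1 t) / circlepath 0 1 t ^ Suc n +
         g (circlepath 0 1 t) * circlepath 0 1 t ^ (n - 1)))) * (2 * pi * \<i> * circlepath 0 1 t)
      = 2 * pi * \<i> * (g (circlepath 0 1 t) * of_real (cos_kernel c N (circlepath 0 1 t)))"
      using kernel[of "circlepath 0 1 t"] by (simp add: circlepath norm_mult mult_ac)
  qed
  from has_integral_mult_right[OF this, of "1 / (2 * pi * \<i>)"] show ?thesis
    by simp
qed

text \<open>A nonnegative kernel of total mass one makes the integral a weighted mean of
  \<open>g\<close>, which cannot exceed a bound on the modulus of \<open>g\<close>.\<close>

lemma norm_convolution_le: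
  assumes g: "g holomorphic_on ball 0 R" and R: "R > 1" and c0: "c 0 = 1"
    and nonneg: "\<And>u. norm u = 1 \<Longrightarrow> 0 \<le> cos_kernel c N u"
    and M: "\<And>u. norm u = 1 \<Longrightarrow> norm (g u) \<le> M"
  shows "norm (\<Sum>n\<le>N. of_real (c n) * fps_nth (fps_expansion g 0) n) \<le> M"
proof -
  have one: "fps_expansion (\<lambda>_. 1) 0 = (1 :: complex fps)"
    by (rule fps_expansion_eqI) simp
  \<comment> \<open>The total mass comes from the integral formula for the constant function
    one.\<close>
  have "((\<lambda>t. Re (of_real (cos_kernel c N (circlepath 0 1 t)))) has_integral
      Re (\<Sum>n\<le>N. of_real (c n) * fps_nth 1 n)) {0..1}"
    using has_integral_mult_cos_kernel[of "\<lambda>_. 1" R c N] R c0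
    by (intro has_integral_Re) (simp add: one)
  moreover have "(\<Sum>n\<le>N. of_real (c n) * fps_nth (1 :: complex fps) n) = 1"
    by (simp add: fps_one_nth c0 if_distrib cong: if_cong)
  ultimately have K: "((\<lambda>t. cos_kernel c N (circlepath 0 1 t)) has_integral 1) {0..1}"
    by (simp only: Re_complex_of_real one_complex.sel)
  have MK: "((\<lambda>t. M * cos_kernel c N (circlepath 0 1 t)) has_integral M) {0..1}"
    using has_integral_mult_right[OF K, of M] by simp
  have G: "((\<lambda>t. g (circlepath 0 1 t) * of_real (cos_kernel c N (circlepath 0 1 t)))
       has_integral (\<Sum>n\<le>N. of_real (c n) * fps_nth (fps_expansion g 0) n)) {0..1}"
    by (rule has_integral_mult_cos_kernel[where R = R]) (use assms in auto)
  have "norm (integral {0..1} (\<lambda>t. g (circlepath 0 1 t) * of_real (cos_kernel c N (circlepath 0 1 t))))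
     \<le> integral {0..1} (\<lambda>t. M * cos_kernel c N (circlepath 0 1 t))"
  proof (rule integral_norm_bound_integral)
    fix t :: real
    have "norm (circlepath 0 1 t) = 1" by (simp add: circlepath norm_mult)
    then show "norm (g (circlepath 0 1 t) * of_real (cos_kernel c N (circlepath 0 1 t)))
        \<le> M * cos_kernel c N (circlepath 0 1 t)"
      using M nonneg by (simp add: norm_mult mult_right_mono)
  qed (use G MK in blast)+
  then show ?thesis
    by (simp only: integral_unique[OF G] integral_unique[OF MK])
qed

section \<open>From convolution to partial sums of functions on the disc\<close>

lemma Hinf_norm_upper:
  assumes "f \<in> Hinf" "norm w < 1"
  shows "norm (f w) \<le> Hinf_norm f"
  unfolding Hinf_norm_def
proof (rule cSUP_upper)
  show "bdd_above ((\<lambda>z. norm (f z)) ` ball 0 1)"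
    using assms(1) by (auto simp: Hinf_def bounded_iff bdd_above_def)
qed (use assms in auto)

lemma fps_nth_fps_expansion_dilation:
  assumes f: "f holomorphic_on ball 0 1" and w: "norm w < 1"
  shows "fps_nth (fps_expansion (\<lambda>u. f (w * u)) 0) n = w ^ n * fps_nth (fps_expansion f 0) n"
proof -
  have "norm (w * u) < 1" if "norm u < 1" for u
    using mult_strict_mono[of "norm w" 1 "norm u" 1] w that by (simp add: norm_mult)
  then have "(deriv ^^ n) (\<lambda>u. f (w * u)) 0 = w ^ n * (deriv ^^ n) f (w * 0)"
    by (intro higher_deriv_compose_linear[OF f, of "ball 0 1"]) auto
  then show ?thesis
    by (simp add: fps_expansion_def)
qed

lemma fps_expansion_nth_1_Neil:
  "f \<in> Neil_algebra \<Longrightarrow> fps_nth (fps_expansion f 0) (Suc 0) = 0"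
  by (simp add: Neil_algebra_def fps_expansion_def)

text \<open>Since \<open>f\<close> need not extend to the circle, the convolution bound is applied
  to the dilations \<open>f (\<rho> z u)\<close> with \<open>\<rho> < 1\<close>, and then
  \<open>\<rho>\<close> tends to one. The value \<open>c 1\<close> is free because it multiplies the
  vanishing linear coefficient.\<close>

lemma norm_partial_sum_le:
  assumes f: "f \<in> Neil_algebra" and c0: "c 0 = 1"
    and c: "\<And>n. 2 \<le> n \<Longrightarrow> n \<le> N \<Longrightarrow> c n = r ^ n"
    and nonneg: "\<And>u. norm u = 1 \<Longrightarrow> 0 \<le> cos_kernel c N u"
    and z: "norm z = 1"
  shows "norm (partial_sum N f (of_real r * z)) \<le> Hinf_norm f"
proof -
  let ?a = "fps_nth (fps_expansion f 0)"
  have fH: "f \<in> Hinf" using f by (simp add: Neil_algebra_def)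
  then have hol: "f holomorphic_on ball 0 1"
    by (simp add: Hinf_def analytic_imp_holomorphic)
  have dil: "norm (\<Sum>n\<le>N. of_real (c n) * ((of_real \<rho> * z) ^ n * ?a n)) \<le> Hinf_norm f"
    if \<rho>: "0 < \<rho>" "\<rho> < 1" for \<rho> :: real
  proof -
    define w where "w = of_real \<rho> * z"
    have w: "norm w = \<rho>" using \<rho> z by (simp add: w_def norm_mult)
    have "(\<lambda>u. f (w * u)) holomorphic_on ball 0 (1 / \<rho>)"
      by (rule holomorphic_on_compose_gen[OF _ hol, unfolded o_def])
         (use w \<rho> in \<open>auto intro!: holomorphic_intros simp: norm_mult field_simps\<close>)
    then have "norm (\<Sum>n\<le>N. of_real (c n) * fps_nth (fps_expansion (\<lambda>u. f (w * u)) 0) n)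
        \<le> Hinf_norm f"
      by (rule norm_convolution_le[where c = c])
         (use \<rho> w c0 nonneg in \<open>auto simp: norm_mult intro!: Hinf_norm_upper[OF fH]\<close>)
    then show ?thesis
      using w \<rho> by (simp add: fps_nth_fps_expansion_dilation[OF hol] w_def)
  qed
  have "((\<lambda>\<rho>. norm (\<Sum>n\<le>N. of_real (c n) * ((of_real \<rho> * z) ^ n * ?a n)))
      \<longlongrightarrow> norm (\<Sum>n\<le>N. of_real (c n) * ((of_real 1 * z) ^ n * ?a n))) (at_left (1::real))"
    by (intro tendsto_intros)
  moreover have "\<forall>\<^sub>F \<rho> in at_left (1::real).
      norm (\<Sum>n\<le>N. of_real (c n) * ((of_real \<rho> * z) ^ n * ?a n)) \<le> Hinf_norm f"
    by (rule eventually_mono[OF eventually_at_left_real[of 0 1]]) (use dil in auto)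
  ultimately have "norm (\<Sum>n\<le>N. of_real (c n) * ((of_real 1 * z) ^ n * ?a n)) \<le> Hinf_norm f"
    by (rule tendsto_upperbound) simp
  also have "(\<Sum>n\<le>N. of_real (c n) * ((of_real 1 * z) ^ n * ?a n)) = partial_sum N f (of_real r * z)"
    unfolding partial_sum_def
  proof (rule sum.cong)
    fix n assume "n \<in> {..N}"
    then consider "n = 0" | "n = 1" | "2 \<le> n" "n \<le> N" by force
    then show "of_real (c n) * ((of_real 1 * z) ^ n * ?a n) = ?a n * (of_real r * z) ^ n"
      by cases (simp_all add: c0 c fps_expansion_nth_1_Neil[OF f] power_mult_distrib)
  qed simp
  finally show ?thesis .
qed

section \<open>Multiple angles and comparison with the Poisson kernel\<close>

lemma Re_power2_unit:
  assumes "norm u = 1"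
  shows "Re (u ^ 2) = 2 * Re u ^ 2 - 1"
  using cmod_power2[of u] assms by (simp add: power2_eq_square algebra_simps)

lemma Re_power3_unit:
  assumes "norm u = 1"
  shows "Re (u ^ 3) = 4 * Re u ^ 3 - 3 * Re u"
proof -
  have *: "Im u ^ 2 = 1 - Re u ^ 2" using cmod_power2[of u] assms by simp
  have "Re (u ^ 3) = Re u ^ 3 - 3 * Re u * Im u ^ 2"
    by (simp add: power3_eq_cube power2_eq_square algebra_simps)
  then show ?thesis unfolding * by (simp add: algebra_simps power3_eq_cube power2_eq_square)
qed

text \<open>The kernel is the real part of \<open>1 + 2 (w + ... + w^N)\<close>; multiplying by
  \<open>1 - w\<close> telescopes the sum. Besides the Poisson numerator \<open>1 - r^2\<close> only
  the truncation term with \<open>w^(N+1)\<close> remains.\<close>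

lemma cos_kernel_geometric:
  assumes u: "norm u = 1" and r: "0 < r" "r < 1" and c: "\<And>n. c n = r ^ n"
  defines "w \<equiv> of_real r * u"
  shows "cos_kernel c N u * (norm (1 - w))\<^sup>2 = 1 - r\<^sup>2 - 2 * Re (w ^ Suc N * (1 - cnj w))"
proof -
  have ww: "w * cnj w = of_real (r\<^sup>2)"
    unfolding complex_norm_square[symmetric] using u r by (simp add: w_def norm_mult)
  have "(\<Sum>n=1..N. w ^ n) * (1 - w) = w - w ^ Suc N"
  proof (induction N)
    case (Suc N)
    have "(\<Sum>n=1..Suc N. w ^ n) * (1 - w) = (\<Sum>n=1..N. w ^ n) * (1 - w) + w ^ Suc N * (1 - w)"
      by (simp add: distrib_right)
    also have "\<dots> = w - w ^ Suc (Suc N)"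
      unfolding Suc.IH by (simp add: algebra_simps)
    finally show ?case .
  qed simp
  moreover have "(1 + 2 * (\<Sum>n=1..N. w ^ n)) * (1 - w) = 1 - w + 2 * ((\<Sum>n=1..N. w ^ n) * (1 - w))"
    by (simp only: distrib_right mult_1 mult.assoc)
  ultimately have "(1 + 2 * (\<Sum>n=1..N. w ^ n)) * (1 - w) = 1 + w - 2 * w ^ Suc N"
    by simp
  then have "(1 + 2 * (\<Sum>n=1..N. w ^ n)) * ((1 - w) * cnj (1 - w))
      = (1 + w - 2 * w ^ Suc N) * (1 - cnj w)"
    by (simp only: mult.assoc[symmetric]) simp
  \<comment> \<open>The difference \<open>w - cnj w\<close> is isolated because it is purely
    imaginary and drops out of the real part.\<close>
  also have "\<dots> = 1 - w * cnj w + (w - cnj w) - 2 * (w ^ Suc N * (1 - cnj w))"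
    by (simp add: algebra_simps)
  also have "(1 - w) * cnj (1 - w) = of_real ((norm (1 - w))\<^sup>2)"
    by (rule complex_norm_square[symmetric])
  finally have "Re ((1 + 2 * (\<Sum>n=1..N. w ^ n)) * of_real ((norm (1 - w))\<^sup>2))
      = Re (1 - of_real (r\<^sup>2) + (w - cnj w) - 2 * (w ^ Suc N * (1 - cnj w)))"
    unfolding ww by (rule arg_cong)
  then have "Re (1 + 2 * (\<Sum>n=1..N. w ^ n)) * (norm (1 - w))\<^sup>2
      = 1 - r\<^sup>2 - 2 * Re (w ^ Suc N * (1 - cnj w))"
    by (simp del: of_real_power power_Suc)
  moreover have "Re (1 + 2 * (\<Sum>n=1..N. w ^ n)) = cos_kernel c N u"
    by (simp add: cos_kernel_def c w_def power_mult_distrib)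
  ultimately show ?thesis
    by (simp only:)
qed

lemma cos_kernel_geometric_nonneg:
  assumes u: "norm u = 1" and r: "0 < r" "r < 1" and c: "\<And>n. c n = r ^ n"
    and "2 * Re ((of_real r * u) ^ Suc N * (1 - cnj (of_real r * u))) \<le> 1 - r\<^sup>2"
  shows "0 \<le> cos_kernel c N u"
proof -
  have "of_real r * u \<noteq> 1"
    using u r by (metis abs_of_pos less_irrefl mult.right_neutral norm_mult norm_of_real norm_one)
  then have "0 < (norm (1 - of_real r * u))\<^sup>2" by simp
  then show ?thesis
    using cos_kernel_geometric[of u r c N] assms
    by (smt (verit) mult_neg_pos)
qed

section \<open>The root \<open>r0\<close> of the cubic\<close>

lemma r0_equation_ex1: "\<exists>!r::real. 4 * r ^ 3 + r - 2 = 0"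
proof -
  have "\<exists>r\<ge>0. r \<le> 1 \<and> 4 * r ^ 3 + r - 2 = (0 :: real)"
    by (rule IVT') (auto intro!: continuous_intros)
  moreover have "r \<le> s" if "4 * r ^ 3 + r - 2 = 0" "4 * s ^ 3 + s - 2 = 0" for r s :: real
    using that power_mono_odd[of 3 s r] by (simp add: odd_numeral) linarith
  ultimately show ?thesis
    by (meson antisym)
qed

lemma r0_root: "4 * r0 ^ 3 + r0 - 2 = 0"
  using theI'[OF r0_equation_ex1] by (simp add: r0_def)

text \<open>Monotonicity of the cubic turns comparison with \<open>r0\<close> into arithmetic; this
  serves both the numerical bounds and sharpness.\<close>

lemma r0_less_iff: "r0 < r \<longleftrightarrow> 2 < 4 * r ^ 3 + r"
proof
  assume "r0 < r"
  then show "2 < 4 * r ^ 3 + r"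
    using power_mono_odd[of 3 r0 r] r0_root by simp
next
  assume "2 < 4 * r ^ 3 + r"
  then show "r0 < r"
    using power_mono_odd[of 3 r r0] r0_root by (intro not_le[THEN iffD1]) auto
qed

text \<open>The value \<open>1379 / 2000 = 0.6895\<close> lies just above \<open>r0\<close>; the
  estimate for order four leaves little room.\<close>

lemma r0_bounds: "1 / 2 < r0" "r0 < 1379 / 2000"
proof -
  have "r0 \<noteq> 1 / 2"
  proof
    assume eq: "r0 = 1 / 2"
    show False using r0_root unfolding eq by (simp add: power3_eq_cube)
  qed
  moreover have "\<not> r0 < 1 / 2"
    unfolding r0_less_iff by (simp add: power3_eq_cube)
  ultimately show "1 / 2 < r0" by linarith
  show "r0 < 1379 / 2000"
    unfolding r0_less_iff by (simp add: power3_eq_cube)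
qed

section \<open>Nonnegative kernels, order by order\<close>

lemma cos_kernel_2_nonneg:
  assumes u: "norm u = 1" and r: "r\<^sup>2 \<le> 1 / 2"
  shows "0 \<le> cos_kernel (\<lambda>n. if n = 1 then 0 else r ^ n) 2 u"
proof -
  \<comment> \<open>With linear coefficient zero the kernel is just
    \<open>1 + 2 r^2 Re (u^2)\<close>.\<close>
  have "\<bar>Re (u ^ 2)\<bar> \<le> 1"
    using abs_Re_le_cmod[of "u ^ 2"] u by (simp add: norm_power)
  then have "\<bar>r\<^sup>2 * Re (u ^ 2)\<bar> \<le> 1 / 2 * 1"
    unfolding abs_mult using r by (intro mult_mono) auto
  then show ?thesis
    by (simp add: cos_kernel_def numeral_2_eq_2)
qed

text \<open>For \<open>r = r0\<close> the best kernel of order three has a double zero at \<open>cos \<theta> = b\<close> and a simple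
  zero at \<open>cos \<theta> = -1\<close>; the equation for \<open>r0\<close> says that its constant term is one.\<close>

lemma cos_kernel_3_nonneg:
  fixes r :: real
  defines "b \<equiv> (2 * r - 1) / (4 * r)"
  assumes u: "norm u = 1" and root: "4 * r ^ 3 + r - 2 = 0" and r: "0 < r"
  shows "0 \<le> cos_kernel (\<lambda>n. if n = 1 then 3 * r ^ 3 + 4 * r ^ 3 * (b\<^sup>2 - 2 * b) else r ^ n) 3 u"
proof -
  define x where "x = Re u"
  \<comment> \<open>The value of \<open>b\<close> is forced by the quadratic coefficient
    \<open>4 r^2\<close> (fact \<open>quad\<close>); \<open>c 1\<close> absorbs the linear
    coefficient, and \<open>root\<close> enters only through the constant one (fact
    \<open>const\<close>).\<close>
  have b: "4 * r * b = 2 * r - 1" using r by (simp add: b_def)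
  have "8 * r ^ 3 * b\<^sup>2 = r / 2 * (4 * r * b)\<^sup>2"
    by (simp add: power2_eq_square power3_eq_cube)
  also have "\<dots> = (4 * r ^ 3 + r) / 2 - 2 * r\<^sup>2"
    unfolding b by (simp add: power2_eq_square power3_eq_cube algebra_simps)
  finally have const: "8 * r ^ 3 * b\<^sup>2 = 1 - 2 * r\<^sup>2" using root by simp
  have "8 * r ^ 3 * (1 - 2 * b) = 8 * r ^ 3 - 4 * r\<^sup>2 * (4 * r * b)"
    by (simp add: power2_eq_square power3_eq_cube algebra_simps)
  also have "\<dots> = 4 * r\<^sup>2"
    unfolding b by (simp add: power2_eq_square power3_eq_cube algebra_simps)
  finally have quad: "8 * r ^ 3 * (1 - 2 * b) = 4 * r\<^sup>2" .
  have "cos_kernel (\<lambda>n. if n = 1 then 3 * r ^ 3 + 4 * r ^ 3 * (b\<^sup>2 - 2 * b) else r ^ n) 3 u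
      = 1 + 2 * ((3 * r ^ 3 + 4 * r ^ 3 * (b\<^sup>2 - 2 * b)) * x + r\<^sup>2 * Re (u ^ 2) + r ^ 3 * Re (u ^ 3))"
    by (simp add: cos_kernel_def x_def numeral_2_eq_2 numeral_3_eq_3)
  also have "\<dots> = 8 * r ^ 3 * x ^ 3 + 4 * r\<^sup>2 * x\<^sup>2 + 8 * r ^ 3 * (b\<^sup>2 - 2 * b) * x + (1 - 2 * r\<^sup>2)"
    unfolding Re_power2_unit[OF u] Re_power3_unit[OF u] x_def by (simp add: algebra_simps)
  also have "\<dots> = 8 * r ^ 3 * (x + 1) * (x - b)\<^sup>2"
    unfolding const[symmetric] quad[symmetric]
    by (simp add: power2_eq_square power3_eq_cube algebra_simps)
  also have "\<dots> \<ge> 0"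
    using abs_Re_le_cmod[of u] u r by (simp add: x_def)
  finally show ?thesis .
qed

text \<open>The triangle bound \<open>r^5 (1 + r)\<close> for the truncation term is slightly too
  large at \<open>r0\<close>. It is nearly attained in \<open>1 - w\<close> only for
  \<open>u\<close> near -1, and there the sign of \<open>Re (u^4)\<close> helps instead.\<close>

lemma cos_kernel_4_nonneg:
  assumes u: "norm u = 1" and r: "0 < r" "r < 1379 / 2000" and c: "\<And>n. c n = r ^ n"
  shows "0 \<le> cos_kernel c 4 u"
proof -
  define w where "w = of_real r * u"
  have r2: "r\<^sup>2 \<le> (1379 / 2000)\<^sup>2" and r5: "r ^ 5 \<le> (1379 / 2000) ^ 5"
    using r by (intro power_mono; simp)+
  have bound: "Re (w ^ 5 * (1 - cnj w)) \<le> r ^ 5 * (167 / 100)"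
  proof (cases "Re u \<ge> - 95 / 100")
    case True
    have "(norm (1 - cnj w))\<^sup>2 = 1 - 2 * r * Re u + r\<^sup>2 * ((Re u)\<^sup>2 + (Im u)\<^sup>2)"
      unfolding cmod_power2 by (simp add: w_def power2_eq_square algebra_simps)
    also have "\<dots> = 1 - 2 * r * Re u + r\<^sup>2"
      using u cmod_power2[of u] by simp
    also have "\<dots> \<le> 1 + 2 * (1379 / 2000) * (95 / 100) + (1379 / 2000)\<^sup>2"
    proof -
      have "r * (- Re u) \<le> r * (95 / 100)" using True r by (intro mult_left_mono) auto
      then have "- (2 * r * Re u) \<le> 2 * (1379 / 2000) * (95 / 100)" using r by simp
      then show ?thesis using r2 by linarith
    qed
    also have "\<dots> \<le> (167 / 100)\<^sup>2" by (simp add: power2_eq_square)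
    finally have "norm (1 - cnj w) \<le> 167 / 100"
      by (rule power2_le_imp_le) simp
    then have "norm (w ^ 5 * (1 - cnj w)) \<le> r ^ 5 * (167 / 100)"
      using r u by (simp add: w_def norm_mult norm_power)
    then show ?thesis
      using complex_Re_le_cmod order_trans by blast
  next
    case False
    \<comment> \<open>Doubling the angle twice: \<open>Re u < -0.95\<close> gives
      \<open>Re (u^2) \<ge> 0.8\<close>, hence \<open>Re (u^4) \<ge> 0.28\<close>.\<close>
    have "(95 / 100)\<^sup>2 \<le> (- Re u)\<^sup>2" using False by (intro power_mono) auto
    then have *: "0 \<le> 2 * (Re u)\<^sup>2 - 1 - 8 / 10"
      by (simp add: power2_eq_square)
    have "Re (u ^ 4) = 2 * (Re (u\<^sup>2))\<^sup>2 - 1"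
      using Re_power2_unit[of "u\<^sup>2"] u by (simp add: norm_power flip: power_mult)
    moreover have "(8 / 10)\<^sup>2 \<le> (Re (u\<^sup>2))\<^sup>2"
      unfolding Re_power2_unit[OF u] using * by (intro power_mono) auto
    ultimately have Re4: "0 \<le> Re (u ^ 4)" by (simp add: power2_eq_square)
    have "w * cnj w = of_real (r\<^sup>2)"
      unfolding complex_norm_square[symmetric] using u r by (simp add: w_def norm_mult)
    moreover have "w ^ 5 * (1 - cnj w) = w ^ 5 - (w * cnj w) * w ^ 4"
      by (simp add: algebra_simps eval_nat_numeral)
    ultimately have "w ^ 5 * (1 - cnj w) = w ^ 5 - of_real (r\<^sup>2) * w ^ 4"
      by (simp only:)
    also have "\<dots> = of_real (r ^ 5) * u ^ 5 - of_real (r ^ 6) * u ^ 4"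
      by (simp add: w_def power_mult_distrib flip: power_add)
    finally have "Re (w ^ 5 * (1 - cnj w)) = r ^ 5 * Re (u ^ 5) - r ^ 6 * Re (u ^ 4)"
      by (simp del: of_real_power)
    moreover have "r ^ 5 * Re (u ^ 5) \<le> r ^ 5 * 1"
      using complex_Re_le_cmod[of "u ^ 5"] u r by (intro mult_left_mono) (auto simp: norm_power)
    moreover have "0 \<le> r ^ 6 * Re (u ^ 4)" "0 \<le> r ^ 5"
      using Re4 r by simp_all
    ultimately show ?thesis
      by linarith
  qed
  have "2 * Re (w ^ 5 * (1 - cnj w)) \<le> 2 * (1379 / 2000) ^ 5 * (167 / 100)"
    using bound r5 by linarith
  also have "\<dots> \<le> 1 - (1379 / 2000 :: real)\<^sup>2"
    by (simp add: eval_nat_numeral)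
  also have "\<dots> \<le> 1 - r\<^sup>2" using r2 by simp
  finally show ?thesis
    using r by (intro cos_kernel_geometric_nonneg[OF u _ _ c]) (auto simp: w_def)
qed

text \<open>From order five on the plain triangle inequality suffices: it reduces the claim to
  \<open>2 r^(N+1) \<le> 1 - r\<close>.\<close>

lemma cos_kernel_ge_5_nonneg:
  assumes u: "norm u = 1" and r: "0 < r" "r < 1379 / 2000" and c: "\<And>n. c n = r ^ n" and N: "5 \<le> N"
  shows "0 \<le> cos_kernel c N u"
proof -
  define w where "w = of_real r * u"
  have w: "norm w = r" using u r by (simp add: w_def norm_mult)
  have "r ^ Suc N \<le> r ^ 6" using N r by (intro power_decreasing) auto
  also have "\<dots> \<le> (1379 / 2000) ^ 6" using r by (intro power_mono) auto
  \<comment> \<open>The constant is \<open>(1 - 1379 / 2000) / 2\<close>.\<close>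
  also have "\<dots> \<le> (621 / 4000 :: real)" by (simp add: eval_nat_numeral)
  finally have rN: "2 * r ^ Suc N \<le> 1 - r" using r by simp
  have "2 * Re (w ^ Suc N * (1 - cnj w)) \<le> 2 * (norm (w ^ Suc N) * norm (1 - cnj w))"
    using complex_Re_le_cmod[of "w ^ Suc N * (1 - cnj w)"] by (simp only: norm_mult)
  also have "\<dots> \<le> 2 * (r ^ Suc N * (1 + r))"
    using norm_triangle_ineq4[of 1 "cnj w"] w r
    by (intro mult_left_mono mult_mono) (simp_all add: norm_power del: power_Suc)
  also have "\<dots> \<le> (1 - r) * (1 + r)"
    using mult_right_mono[OF rN, of "1 + r"] r by (simp add: mult.assoc)
  also have "\<dots> = 1 - r\<^sup>2" by (simp add: power2_eq_square algebra_simps)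
  finally show ?thesis
    using r by (intro cos_kernel_geometric_nonneg[OF u _ _ c]) (auto simp: w_def)
qed

section \<open>Suprema over the circle and the bound at \<open>r0\<close>\<close>

lemma circle_sup_upper:
  assumes "norm z = 1"
  shows "norm (partial_sum N f (of_real r * z)) \<le> circle_sup N f r"
  unfolding circle_sup_def
proof (rule cSUP_upper)
  have "compact ((\<lambda>z. norm (partial_sum N f (of_real r * z))) ` sphere 0 1)"
    unfolding partial_sum_def by (intro compact_continuous_image continuous_intros) auto
  then show "bdd_above ((\<lambda>z. norm (partial_sum N f (of_real r * z))) ` sphere 0 1)"
    by (intro bounded_imp_bdd_above compact_imp_bounded)
qed (use assms in auto)

lemma circle_sup_r0_le:
  assumes f: "f \<in> Neil_algebra" and N: "1 \<le> N"
  shows "circle_sup N f r0 \<le> Hinf_norm f"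
  unfolding circle_sup_def
proof (rule cSUP_least)
  fix z :: complex assume "z \<in> sphere 0 1"
  then have z: "norm z = 1" by simp
  note r = less_trans[OF _ r0_bounds(1), of 0, simplified] r0_bounds(2)
  \<comment> \<open>The linear coefficient is zero for \<open>N \<le> 2\<close>, the tuned one for
    \<open>N = 3\<close>, and \<open>r0\<close> from \<open>N = 4\<close> on.\<close>
  consider "N = 1" | "N = 2" | "N = 3" | "N = 4" | "5 \<le> N" using N by linarith
  then show "norm (partial_sum N f (of_real r0 * z)) \<le> Hinf_norm f"
  proof cases
    case 1
    show ?thesis unfolding 1
      by (rule norm_partial_sum_le[OF f _ _ _ z, where c = "\<lambda>n. if n = 1 then 0 else r0 ^ n"])
         (simp_all add: cos_kernel_def)
  next
    case 2
    have "r0\<^sup>2 \<le> (1379 / 2000)\<^sup>2" using r by (intro power_mono) auto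
    then have "r0\<^sup>2 \<le> 1 / 2" by (simp add: power2_eq_square)
    then show ?thesis unfolding 2
      by (intro norm_partial_sum_le[OF f _ _ _ z, where c = "\<lambda>n. if n = 1 then 0 else r0 ^ n"]
          cos_kernel_2_nonneg) simp_all
  next
    case 3
    show ?thesis unfolding 3
      by (rule norm_partial_sum_le[OF f _ _ cos_kernel_3_nonneg z]) (use r0_root r in simp_all)
  next
    case 4
    show ?thesis unfolding 4
      by (rule norm_partial_sum_le[OF f _ _ _ z, where c = "\<lambda>n. r0 ^ n"])
         (use r in \<open>auto intro: cos_kernel_4_nonneg\<close>)
  next
    case 5
    then show ?thesis
      by (intro norm_partial_sum_le[OF f _ _ _ z, where c = "\<lambda>n. r0 ^ n"])
         (use r in \<open>auto intro: cos_kernel_ge_5_nonneg\<close>)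
  qed
qed auto

section \<open>Disc automorphisms and the extremal functions\<close>

lemma disc_automorphism_nonzero:
  fixes w :: complex
  assumes "0 \<le> q" "q < 1" "norm w \<le> 1"
  shows "1 + of_real q * w \<noteq> 0"
proof
  assume "1 + of_real q * w = 0"
  then have "of_real q * w = -1" by (simp add: add_eq_0_iff)
  then have "q * norm w = 1"
    using assms by (metis abs_of_nonneg norm_minus_cancel norm_mult norm_of_real norm_one)
  then show False
    using mult_mono[of q q "norm w" 1] assms by auto
qed

text \<open>The squared moduli of denominator and numerator differ by
  \<open>(1 - q^2) (1 - |w|^2)\<close>.\<close>

lemma disc_automorphism_norm_le:
  fixes w :: complex
  assumes "0 \<le> q" "q < 1" "norm w \<le> 1"
  shows "norm ((of_real q + w) / (1 + of_real q * w)) \<le> 1"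
proof -
  have "(norm (1 + of_real q * w))\<^sup>2 - (norm (of_real q + w))\<^sup>2 = (1 - q\<^sup>2) * (1 - (norm w)\<^sup>2)"
    unfolding cmod_power2 by (simp add: power2_eq_square algebra_simps)
  moreover have "0 \<le> (1 - q\<^sup>2) * (1 - (norm w)\<^sup>2)"
    using assms by (intro mult_nonneg_nonneg) (auto simp: power_le_one)
  ultimately have "(norm (of_real q + w))\<^sup>2 \<le> (norm (1 + of_real q * w))\<^sup>2"
    by linarith
  then have "norm (of_real q + w) \<le> norm (1 + of_real q * w)"
    by (rule power2_le_imp_le) simp
  then show ?thesis
    by (simp add: norm_divide divide_le_eq_1)
qed

text \<open>As \<open>q \<rightarrow> 1\<close> the disc automorphism \<open>(q + w) / (1 + q w)\<close> tends to the constant \<open>1\<close>, which is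
  extremal at \<open>r0\<close>; composing it with a suitable Blaschke product \<open>w\<close> vanishing to second order at
  \<open>0\<close> gives the extremal direction at radius \<open>r\<close>.\<close>

definition extremal :: "real \<Rightarrow> real \<Rightarrow> complex \<Rightarrow> complex" where
  "extremal q a z = (let w = z\<^sup>2 * ((of_real a + z) / (1 + of_real a * z))
     in (of_real q + w) / (1 + of_real q * w))"

context
  fixes q a :: real
  assumes q: "0 \<le> q" "q < 1" and a: "0 \<le> a" "a < 1"
begin

lemma norm_blaschke_le_1:
  assumes "norm (z :: complex) < 1"
  shows "norm (z\<^sup>2 * ((of_real a + z) / (1 + of_real a * z))) \<le> 1"
  unfolding norm_mult
  using assms disc_automorphism_norm_le[OF a, of z]
  by (intro mult_le_one) (auto simp: norm_power power_le_one)

lemma norm_extremal_le_1: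
  assumes "norm z < 1"
  shows "norm (extremal q a z) \<le> 1"
  unfolding extremal_def Let_def
  by (rule disc_automorphism_norm_le[OF q norm_blaschke_le_1[OF assms]])

lemma extremal_holomorphic: "extremal q a holomorphic_on ball 0 1"
proof -
  have "1 + of_real a * z \<noteq> 0"
    and "1 + of_real q * (z\<^sup>2 * ((of_real a + z) / (1 + of_real a * z))) \<noteq> 0"
    if "z \<in> ball 0 1" for z :: complex
    using disc_automorphism_nonzero[OF q norm_blaschke_le_1, of z]
      disc_automorphism_nonzero[OF a, of z] that by simp_all
  then show ?thesis
    unfolding extremal_def Let_def by (intro holomorphic_intros)
qed

text \<open>Clearing both nested denominators leaves a linear equation with polynomial coefficients,
  ready for comparison of power series.\<close>

lemma extremal_equation:
  assumes "norm z < 1"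
  shows "extremal q a z + of_real a * (z * extremal q a z)
      + of_real q * (of_real a * (z ^ 2 * extremal q a z) + z ^ 3 * extremal q a z)
    = of_real q * (1 + of_real a * z) + (of_real a * z ^ 2 + z ^ 3)"
proof -
  define d where "d = 1 + of_real a * z"
  define v where "v = (of_real a + z) / d"
  have d: "d \<noteq> 0" "1 + of_real q * (z\<^sup>2 * v) \<noteq> 0"
    using disc_automorphism_nonzero[OF q norm_blaschke_le_1, of z]
      disc_automorphism_nonzero[OF a, of z] assms by (auto simp: d_def v_def)
  have vd: "v * d = of_real a + z" using d by (simp add: v_def)
  have "extremal q a z * (1 + of_real q * (z\<^sup>2 * v)) = of_real q + z\<^sup>2 * v"
    using d by (simp add: extremal_def Let_def v_def d_def)
  then have "extremal q a z * (1 + of_real q * (z\<^sup>2 * v)) * d = (of_real q + z\<^sup>2 * v) * d"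
    by simp
  then have "extremal q a z * (d + of_real q * (z\<^sup>2 * (v * d))) = of_real q * d + z\<^sup>2 * (v * d)"
    by (simp only: distrib_right distrib_left mult.assoc mult_1 mult_1_right)
  then show ?thesis
    unfolding vd by (simp add: d_def algebra_simps power2_eq_square power3_eq_cube)
qed

text \<open>Comparing coefficients in the cleared equation gives a recursion that determines them
  one after another.\<close>

lemma extremal_coeffs:
  defines "c \<equiv> fps_nth (fps_expansion (extremal q a) 0)"
  shows "c 0 = of_real q" "c (Suc 0) = 0" "c 2 = of_real (a * (1 - q\<^sup>2))"
    "c 3 = of_real ((1 - q\<^sup>2) * (1 - a\<^sup>2))"
proof -
  let ?F = "fps_expansion (extremal q a) 0"
  have F: "extremal q a has_fps_expansion ?F"
    by (rule has_fps_expansion_fps_expansion[OF _ _ extremal_holomorphic]) auto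
  let ?L = "?F + fps_const (of_real a) * (fps_X * ?F)
      + fps_const (of_real q) * (fps_const (of_real a) * (fps_X ^ 2 * ?F) + fps_X ^ 3 * ?F)"
  let ?R = "fps_const (of_real q) * (1 + fps_const (of_real a) * fps_X)
      + (fps_const (of_real a) * fps_X ^ 2 + fps_X ^ 3) :: complex fps"
  have has: "(\<lambda>z. extremal q a z + of_real a * (z * extremal q a z)
      + of_real q * (of_real a * (z ^ 2 * extremal q a z) + z ^ 3 * extremal q a z))
      has_fps_expansion ?L"
    by (intro fps_expansion_intros F)
  have ev: "\<forall>\<^sub>F z in nhds 0. extremal q a z + of_real a * (z * extremal q a z)
      + of_real q * (of_real a * (z ^ 2 * extremal q a z) + z ^ 3 * extremal q a z)
      = of_real q * (1 + of_real a * z) + (of_real a * z ^ 2 + z ^ 3)"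
    using eventually_nhds_in_open[of "ball 0 1" "0 :: complex"]
    by (auto elim!: eventually_mono simp: extremal_equation)
  have "(\<lambda>z. of_real q * (1 + of_real a * z) + (of_real a * z ^ 2 + z ^ 3))
      has_fps_expansion ?L"
    by (rule has_fps_expansion_cong[OF ev refl, THEN iffD1, OF has])
  then have "fps_expansion (\<lambda>z. of_real q * (1 + of_real a * z) + (of_real a * z ^ 2 + z ^ 3)) 0 = ?L"
    by (rule fps_expansion_eqI)
  moreover have "fps_expansion (\<lambda>z. of_real q * (1 + of_real a * z) + (of_real a * z ^ 2 + z ^ 3)) 0 = ?R"
    by (intro fps_expansion_eqI fps_expansion_intros)
  ultimately have eq: "?L = ?R"
    by (simp only:)
  have nth: "fps_nth ?L n = fps_nth ?R n" for n
    by (simp only: eq)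
  show c0: "c 0 = of_real q"
    using nth[of 0] by (simp add: c_def fps_X_power_mult_nth)
  show c1: "c (Suc 0) = 0"
    using nth[of 1] c0 by (simp add: c_def fps_X_power_mult_nth fps_X_power_nth)
  show c2: "c 2 = of_real (a * (1 - q\<^sup>2))"
    using nth[of 2] c0 c1
    by (simp add: c_def fps_X_power_mult_nth fps_X_power_nth eval_nat_numeral algebra_simps)
  show "c 3 = of_real ((1 - q\<^sup>2) * (1 - a\<^sup>2))"
  proof -
    have "c 3 + of_real a * c 2 + of_real q * of_real q = 1"
      using nth[of 3] c0 c1
      by (simp add: c_def fps_X_power_mult_nth fps_X_power_nth eval_nat_numeral algebra_simps)
    then have "c 3 = 1 - of_real q * of_real q - of_real a * of_real (a * (1 - q\<^sup>2))"
      unfolding c2 by (simp add: algebra_simps)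
    then show ?thesis
      by (simp add: power2_eq_square algebra_simps)
  qed
qed

lemma extremal_Neil: "extremal q a \<in> Neil_algebra"
proof -
  have "bounded (extremal q a ` ball 0 1)"
    by (auto simp: bounded_iff intro!: exI[of _ 1] norm_extremal_le_1)
  moreover have "deriv (extremal q a) 0 = 0"
    using extremal_coeffs(2) by (simp add: fps_expansion_def)
  ultimately show ?thesis
    using extremal_holomorphic by (simp add: Neil_algebra_def Hinf_def analytic_on_open)
qed

lemma Hinf_norm_extremal_le: "Hinf_norm (extremal q a) \<le> 1"
  unfolding Hinf_norm_def by (rule cSUP_least) (auto intro: norm_extremal_le_1)

lemma partial_sum_3_extremal:
  "partial_sum 3 (extremal q a) (of_real r)
     = of_real (q + (1 - q\<^sup>2) * (a * r\<^sup>2 + (1 - a\<^sup>2) * r ^ 3))"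
proof -
  have "{..3::nat} = {0, Suc 0, 2, 3}" 
    by (simp add: eval_nat_numeral atMost_Suc insert_commute)
  then show ?thesis
    unfolding partial_sum_def by (simp add: extremal_coeffs algebra_simps)
qed

end

section \<open>Sharpness beyond \<open>r0\<close>\<close>

lemma exists_circle_sup_3_gt:
  assumes r: "r0 < r"
  shows "\<exists>f\<in>Neil_algebra. Hinf_norm f < circle_sup 3 f r"
proof -
  define s where "s = (4 * r ^ 3 + r) / 4"
  \<comment> \<open>This \<open>a\<close> maximises \<open>a r^2 + (1 - a^2) r^3\<close>, with
    maximum \<open>s\<close>; then \<open>q\<close> maximises \<open>q + (1 - q^2) s\<close>. The
    condition \<open>r > r0\<close> says \<open>s > 1 / 2\<close>, which is exactly what makes
    \<open>q < 1\<close>.\<close>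
  define a where "a = 1 / (2 * r)"
  define q where "q = 1 / (2 * s)"
  have r12: "1 / 2 < r" using r r0_bounds by linarith
  have s: "1 / 2 < s" using r by (simp add: s_def r0_less_iff)
  have a: "0 \<le> a" "a < 1" using r12 by (auto simp: a_def)
  have q: "0 \<le> q" "q < 1" and qs: "q * s = 1 / 2" using s by (auto simp: q_def)
  have "a * r\<^sup>2 + (1 - a\<^sup>2) * r ^ 3 = s"
    using r12 by (simp add: a_def s_def field_simps power2_eq_square power3_eq_cube)
  then have P: "partial_sum 3 (extremal q a) (of_real r * 1) = of_real (q + (1 - q\<^sup>2) * s)"
    using partial_sum_3_extremal[OF q a, of r] by simp
  have "q + (1 - q\<^sup>2) * s - 1 = (1 - q) * (s + q * s - 1)"
    by (simp add: power2_eq_square algebra_simps)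
  also have "\<dots> > 0" using q s qs by simp
  finally have "1 < q + (1 - q\<^sup>2) * s" by simp
  also have "\<dots> \<le> norm (partial_sum 3 (extremal q a) (of_real r * 1))"
    unfolding P norm_of_real by simp
  also have "\<dots> \<le> circle_sup 3 (extremal q a) r"
    by (rule circle_sup_upper) simp
  finally show ?thesis
    using extremal_Neil[OF q a] Hinf_norm_extremal_le[OF q a] by (intro bexI[of _ "extremal q a"]) auto
qed

theorem theorem2p1:
  shows "(\<exists>!r::real. 4 * r ^ 3 + r - 2 = 0) \<and>
    (\<forall>f\<in>Neil_algebra. \<forall>N\<ge>1. circle_sup N f r0 \<le> Hinf_norm f) \<and>
    is_largest_admissible_radius 3 r0 \<and>
    (\<forall>r>r0. \<exists>f\<in>Neil_algebra. \<exists>N\<ge>1. circle_sup N f r > Hinf_norm f)"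
proof (intro conjI)
  show "\<forall>f\<in>Neil_algebra. \<forall>N\<ge>1. circle_sup N f r0 \<le> Hinf_norm f"
    using circle_sup_r0_le by blast
  show "is_largest_admissible_radius 3 r0"
    unfolding is_largest_admissible_radius_def admissible_radius_def
  proof (intro conjI allI impI ballI)
    fix f :: "complex \<Rightarrow> complex" assume "f \<in> Neil_algebra"
    then show "circle_sup 3 f r0 \<le> Hinf_norm f" by (rule circle_sup_r0_le) simp
  next
    fix r assume "\<forall>f\<in>Neil_algebra. circle_sup 3 f r \<le> Hinf_norm f"
    then show "r \<le> r0" using exists_circle_sup_3_gt[of r] by force
  qed
  show "\<forall>r>r0. \<exists>f\<in>Neil_algebra. \<exists>N\<ge>1. circle_sup N f r > Hinf_norm f"
  proof (intro allI impI)
    fix r assume "r0 < r"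
    then obtain f where "f \<in> Neil_algebra" "Hinf_norm f < circle_sup 3 f r"
      using exists_circle_sup_3_gt by blast
    then show "\<exists>f\<in>Neil_algebra. \<exists>N\<ge>1. circle_sup N f r > Hinf_norm f"
      by (intro bexI[of _ f] exI[of _ 3]) auto
  qed
qed (rule r0_equation_ex1)

end
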